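(* Let $\alpha\ge 3$ and $\beta\ge 1$ be integers and let $T=T_{\alpha,\beta}$ be the balanced spider with $\alpha$ legs each of length $\beta$. Then $\operatorname{th}_f(T)=1+\alpha\hat s+t$, where \[\hat s=\left\lfloor\sqrt{\frac{2\beta+\alpha+1}{4\alpha}}\right\rfloor\qquad\text{and}\qquad t=\left\lceil\frac{\beta-\hat s}{2\hat s+1}\right\rceil=\left\lceil\frac{\beta+\frac12}{2\hat s+1}-\frac12\right\rceil .\]
   Context: All graphs are finite and simple. Full forcing: given a graph $G$ and an initial set $B\subseteq V(G)$ of blue vertices (all others white), in each time step every white vertex having a blue neighbor becomes blue. The full forcing propagation time $\operatorname{pt}_f(G;B)$ is the least number $k\ge 0$ of time steps after which all vertices of $G$ are blue ($\infty$ if this never happens). The full throttling number of $B$ is $\operatorname{th}_f(G;B)=|B|+\operatorname{pt}_f(G;B)$, and $\operatorname{th}_f(G)=\min_{B\subseteq V(G)}\operatorname{th}_f(G;B)$. The balanced spider $T_{\alpha,\beta}$ is the (unweighted) tree on $\alpha\beta+1$ vertices consisting of a center vertex $c$ and $\alpha$ disjoint paths (legs), each with $\beta$ vertices, with $c$ adjacent to exactly one end vertex of each path. *)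

theory Defs
  imports
    "Graph_Theory.Pair_Digraph"
    "HOL-Analysis.Analysis"
begin

text \<open>
  Finite simple graphs are the pair digraphs that satisfy the locale \<^locale>\<open>pair_graph\<close>:
  an undirected edge is represented by its two arcs. The definitions below are meant
  for such graphs.
\<close>

definition full_forcing_step :: "'a pair_pre_digraph \<Rightarrow> 'a set \<Rightarrow> 'a set" where
  "full_forcing_step G B = B \<union> {w \<in> pverts G. \<exists>u\<in>B. (u, w) \<in> parcs G}"

text \<open>In \<^typ>\<open>enat\<close> the infimum is a minimum, except that the infimum of the empty set
  is \<^term>\<open>\<infinity> :: enat\<close>.\<close>
definition pt_f :: "'a pair_pre_digraph \<Rightarrow> 'a set \<Rightarrow> enat" where
  "pt_f G B = Inf {enat k | k. (full_forcing_step G ^^ k) B = pverts G}"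

definition th_f_set :: "'a pair_pre_digraph \<Rightarrow> 'a set \<Rightarrow> enat" where
  "th_f_set G B = enat (card B) + pt_f G B"

definition th_f :: "'a pair_pre_digraph \<Rightarrow> enat" where
  "th_f G = Min (th_f_set G ` Pow (pverts G))"

text \<open>\<open>Leg i j\<close> is the vertex of leg \<open>i\<close> at distance \<open>j\<close> from the center; both
  indices start at 1.\<close>
datatype spider_vertex = Center | Leg nat nat

definition spider_verts :: "nat \<Rightarrow> nat \<Rightarrow> spider_vertex set" where
  "spider_verts \<alpha> \<beta> = insert Center {Leg i j | i j. i \<in> {1..\<alpha>} \<and> j \<in> {1..\<beta>}}"

definition spider_edges :: "nat \<Rightarrow> nat \<Rightarrow> (spider_vertex \<times> spider_vertex) set" where
  "spider_edges \<alpha> \<beta> =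
     {(Center, Leg i 1) | i. i \<in> {1..\<alpha>} \<and> 1 \<le> \<beta>} \<union>
     {(Leg i j, Leg i (j + 1)) | i j. i \<in> {1..\<alpha>} \<and> 1 \<le> j \<and> j < \<beta>}"

definition balanced_spider :: "nat \<Rightarrow> nat \<Rightarrow> spider_vertex pair_pre_digraph" where
  "balanced_spider \<alpha> \<beta> =
     \<lparr> pverts = spider_verts \<alpha> \<beta>,
       parcs = spider_edges \<alpha> \<beta> \<union> (spider_edges \<alpha> \<beta>)\<inverse> \<rparr>"

lemma spider_verts_eq:
  "spider_verts \<alpha> \<beta> = insert Center ((\<lambda>(i, j). Leg i j) ` ({1..\<alpha>} \<times> {1..\<beta>}))"
  unfolding spider_verts_def by (auto simp: image_iff)

lemma finite_spider_verts: "finite (spider_verts \<alpha> \<beta>)"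
  by (simp add: spider_verts_eq)

lemma card_spider_verts: "card (spider_verts \<alpha> \<beta>) = \<alpha> * \<beta> + 1"
proof -
  have "inj_on (\<lambda>(i, j). Leg i j) ({1..\<alpha>} \<times> {1..\<beta>})"
    by (auto simp: inj_on_def)
  then have "card ((\<lambda>(i, j). Leg i j) ` ({1..\<alpha>} \<times> {1..\<beta>})) = \<alpha> * \<beta>"
    by (simp add: card_image)
  moreover have "Center \<notin> (\<lambda>(i, j). Leg i j) ` ({1..\<alpha>} \<times> {1..\<beta>})"
    by auto
  ultimately show ?thesis
    by (simp add: spider_verts_eq)
qed

lemma pair_graph_balanced_spider: "pair_graph (balanced_spider \<alpha> \<beta>)"
proof -
  let ?G = "balanced_spider \<alpha> \<beta>"
  have sub: "parcs ?G \<subseteq> pverts ?G \<times> pverts ?G"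
    by (auto simp: balanced_spider_def spider_verts_def spider_edges_def)
  have fin: "finite (pverts ?G)"
    by (simp add: balanced_spider_def finite_spider_verts)
  have fin': "finite (parcs ?G)"
    using finite_subset[OF sub] fin by simp
  have "fst e \<noteq> snd e" if "e \<in> parcs ?G" for e
    using that by (auto simp: balanced_spider_def spider_edges_def)
  moreover have "sym (parcs ?G)"
    by (auto simp: balanced_spider_def sym_def)
  ultimately show ?thesis
    using sub fin fin'
    by unfold_locales (auto simp: symmetric_def)
qed

end

theory Submission
  imports Defs
begin

text \<open>
  A set \<open>B\<close> fills the spider in \<open>k\<close> steps exactly when every vertex is within distance \<open>k\<close>
  of \<open>B\<close>. If the center is in \<open>B\<close> and every leg contains \<open>n\<close> vertices of \<open>B\<close>, the center
  reaches \<open>k\<close> vertices of each leg and any other vertex of \<open>B\<close> reaches at most \<open>2 * k + 1\<close>,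
  so that \<open>\<beta> \<le> k + n * (2 * k + 1)\<close>, which is the symmetric condition
  \<open>2 * \<beta> + 1 \<le> (2 * n + 1) * (2 * k + 1)\<close>. Conversely, evenly spaced vertices show that
  this condition suffices (\<open>th_f_spider_le\<close>). The optimum over these symmetric
  configurations is the minimum of \<open>1 + \<alpha> * n + k\<close> under the condition. Its real
  relaxation in \<open>k\<close> is the convex function \<open>\<alpha> * n + (\<beta> + 1/2) / (2 * n + 1)\<close> up to a
  constant. Two consecutive values, at \<open>n - 1\<close> and \<open>n\<close>, compare like
  \<open>2 * \<beta> + 1\<close> and \<open>\<alpha> * (4 * n\<^sup>2 - 1)\<close>, which gives the square root in the definition of
  \<open>s\<close>; as \<open>\<alpha> * n\<close> is an integer, rounding \<open>k\<close> up keeps the minimizer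
  (\<open>symmetric_cost_minimum\<close>).

  It remains to see that no other set is cheaper than the best symmetric configuration
  (\<open>symmetric_configuration_dominates\<close>). Let \<open>n\<close> be the least number of vertices of \<open>B\<close> on a
  leg. If \<open>B\<close> contains the center, replacing every leg by one with \<open>n\<close> vertices does not
  increase the cost. If it does not, let \<open>i\<close> be a leg with a vertex of \<open>B\<close> nearest to the
  center; that leg and the center are covered from inside the leg, so
  \<open>\<beta> + 1 \<le> m * (2 * k + 1)\<close> for the number \<open>m\<close> of vertices of \<open>B\<close> on it. When \<open>m > n\<close>, the
  surplus vertex on leg \<open>i\<close> pays for the center. When \<open>m = n\<close>, there are at least
  \<open>\<alpha> * m\<close> vertices in \<open>B\<close>, and the center is paid for by trading vertices for time: with
  \<open>k \<ge> 2 * m\<close>, adding the center saves a time step; with \<open>k < 2 * m\<close>, removing one vertex from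
  each leg leaves, after adding the center, \<open>\<alpha> - 1 \<ge> 2\<close> further time steps, which suffice.
\<close>

section \<open>Full forcing and distances in the spider\<close>

lemma in_full_forcing_step_iff:
  "v \<in> full_forcing_step G B \<longleftrightarrow> v \<in> B \<or> v \<in> pverts G \<and> (\<exists>u\<in>B. (u, v) \<in> parcs G)"
  by (auto simp: full_forcing_step_def)

lemma full_forcing_iter_subset:
  "B \<subseteq> pverts G \<Longrightarrow> (full_forcing_step G ^^ k) B \<subseteq> pverts G"
  by (induction k) (auto simp: full_forcing_step_def)

fun spider_dist :: "spider_vertex \<Rightarrow> spider_vertex \<Rightarrow> nat" where
  "spider_dist Center Center = 0"
| "spider_dist Center (Leg i j) = j"
| "spider_dist (Leg i j) Center = j"
| "spider_dist (Leg i j) (Leg i' j') = (if i = i' then (j - j') + (j' - j) else j + j')"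

lemma spider_dist_self: "spider_dist v v = 0"
  by (cases v) auto

lemma spider_dist_arc:
  assumes "(v, w) \<in> parcs (balanced_spider \<alpha> \<beta>)"
  shows "spider_dist u w \<le> spider_dist u v + 1"
  using assms by (cases u) (auto simp: balanced_spider_def spider_edges_def)

lemma full_forcing_within_distance:
  assumes "v \<in> (full_forcing_step (balanced_spider \<alpha> \<beta>) ^^ k) B"
  shows "\<exists>u\<in>B. spider_dist u v \<le> k"
  using assms
proof (induction k arbitrary: v)
  case 0
  then show ?case using spider_dist_self by force
next
  case (Suc k)
  let ?S = "(full_forcing_step (balanced_spider \<alpha> \<beta>) ^^ k) B"
  from Suc.prems consider "v \<in> ?S"
    | w where "w \<in> ?S" "(w, v) \<in> parcs (balanced_spider \<alpha> \<beta>)"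
    by (auto simp: in_full_forcing_step_iff)
  then show ?case
  proof cases
    case 1
    then show ?thesis using Suc.IH le_SucI by blast
  next
    case 2
    then obtain u where "u \<in> B" "spider_dist u w \<le> k" using Suc.IH by blast
    moreover have "spider_dist u v \<le> spider_dist u w + 1"
      by (rule spider_dist_arc[OF 2(2)])
    ultimately show ?thesis by force
  qed
qed

text \<open>Counting the center as position 0 of every leg makes each leg, together with the
  center, a path on the positions \<open>0, \<dots>, \<beta>\<close>.\<close>
definition leg_pos :: "nat \<Rightarrow> nat \<Rightarrow> spider_vertex" where
  "leg_pos i j = (if j = 0 then Center else Leg i j)"

lemma leg_pos_in_verts:
  "i \<in> {1..\<alpha>} \<Longrightarrow> j \<le> \<beta> \<Longrightarrow> leg_pos i j \<in> pverts (balanced_spider \<alpha> \<beta>)"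
  by (auto simp: leg_pos_def balanced_spider_def spider_verts_def)

lemma leg_pos_arc:
  assumes "i \<in> {1..\<alpha>}" "j < \<beta>"
  shows "(leg_pos i j, leg_pos i (Suc j)) \<in> parcs (balanced_spider \<alpha> \<beta>)"
    and "(leg_pos i (Suc j), leg_pos i j) \<in> parcs (balanced_spider \<alpha> \<beta>)"
  using assms by (auto simp: leg_pos_def balanced_spider_def spider_edges_def)

lemma full_forcing_along_leg:
  assumes "i \<in> {1..\<alpha>}" "leg_pos i j \<in> B" "j \<le> \<beta>" "j' \<le> \<beta>" "j' \<le> j + k" "j \<le> j' + k"
  shows "leg_pos i j' \<in> (full_forcing_step (balanced_spider \<alpha> \<beta>) ^^ k) B"
  using assms(4-6)
proof (induction k arbitrary: j')
  case 0
  then show ?case using assms(2) by simp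
next
  case (Suc k)
  let ?G = "balanced_spider \<alpha> \<beta>"
  let ?S = "(full_forcing_step ?G ^^ k) B"
  have step: "leg_pos i j' \<in> full_forcing_step ?G ?S"
    if "w \<in> ?S" "(w, leg_pos i j') \<in> parcs ?G" for w
    using that leg_pos_in_verts[OF assms(1) Suc.prems(1)]
    by (auto simp: in_full_forcing_step_iff)
  consider "j' \<le> j + k" "j \<le> j' + k" | "j' = Suc (j + k)" | "j = Suc (j' + k)"
    using Suc.prems by linarith
  then show ?case
  proof cases
    case 1
    then show ?thesis using Suc.IH[OF Suc.prems(1)] by (simp add: in_full_forcing_step_iff)
  next
    case 2
    then have "leg_pos i (j + k) \<in> ?S" using Suc.IH[of "j + k"] Suc.prems by simp
    then show ?thesis using step leg_pos_arc(1)[OF assms(1), of "j + k" \<beta>] 2 Suc.prems by simp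
  next
    case 3
    then have "leg_pos i (Suc j') \<in> ?S" using Suc.IH[of "Suc j'"] Suc.prems assms(3) by simp
    then show ?thesis using step leg_pos_arc(2)[OF assms(1), of j' \<beta>] 3 assms(3) by simp
  qed
qed

section \<open>Evenly spaced configurations\<close>

text \<open>Place a vertex at every multiple of \<open>2 * t + 1\<close> up to the \<open>s\<close>-th on each leg, including
  the center as multiple 0. A last multiple that falls beyond the leg is moved back to its
  end.\<close>
lemma th_f_spider_le:
  assumes "\<alpha> \<ge> 1" and cover: "2 * \<beta> + 1 \<le> (2 * s + 1) * (2 * t + 1)"
  shows "th_f (balanced_spider \<alpha> \<beta>) \<le> enat (1 + \<alpha> * s + t)"
proof -
  let ?G = "balanced_spider \<alpha> \<beta>"
  let ?p = "\<lambda>r. min (r * (2 * t + 1)) \<beta>"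
  define B where "B = insert Center ((\<lambda>(i, r). leg_pos i (?p r)) ` ({1..\<alpha>} \<times> {1..s}))"
  have "B \<subseteq> pverts ?G"
    unfolding B_def
    by (auto intro!: leg_pos_in_verts) (simp add: balanced_spider_def spider_verts_def)
  have card: "card B \<le> 1 + \<alpha> * s"
  proof -
    have "card ((\<lambda>(i, r). leg_pos i (?p r)) ` ({1..\<alpha>} \<times> {1..s})) \<le> card ({1..\<alpha>} \<times> {1..s})"
      by (rule card_image_le) simp
    then show ?thesis
      unfolding B_def by (simp add: card_insert_if)
  qed
  have reached: "leg_pos i j \<in> (full_forcing_step ?G ^^ t) B" if "i \<in> {1..\<alpha>}" "j \<le> \<beta>" for i j
  proof -
    \<comment> \<open>the index of the multiple of \<open>2 * t + 1\<close> nearest to \<open>j\<close>\<close>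
    define r where "r = (j + t) div (2 * t + 1)"
    have lo: "r * (2 * t + 1) \<le> j + t"
      unfolding r_def by (rule div_times_less_eq_dividend)
    have hi: "j + t < r * (2 * t + 1) + (2 * t + 1)"
      unfolding r_def using dividend_less_div_times[of "2 * t + 1" "j + t"] by simp
    have "j + t < (s + 1) * (2 * t + 1)"
      using cover that(2) by (simp add: algebra_simps)
    then have "r < s + 1"
      unfolding r_def by (rule less_mult_imp_div_less)
    then have "leg_pos i (?p r) \<in> B"
      using that(1) by (cases "r = 0") (auto simp: B_def leg_pos_def image_iff)
    then show ?thesis
      by (rule full_forcing_along_leg[OF that(1)]) (use that(2) lo hi in auto)
  qed
  have "pverts ?G \<subseteq> (full_forcing_step ?G ^^ t) B"
  proof
    fix v assume "v \<in> pverts ?G"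
    then show "v \<in> (full_forcing_step ?G ^^ t) B"
      using reached[of 1 0] reached assms(1)
      by (cases v) (fastforce simp: balanced_spider_def spider_verts_def leg_pos_def)+
  qed
  then have "(full_forcing_step ?G ^^ t) B = pverts ?G"
    using full_forcing_iter_subset[OF \<open>B \<subseteq> pverts ?G\<close>] by blast
  then have "pt_f ?G B \<le> enat t"
    unfolding pt_f_def by (intro Inf_lower) blast
  then have "th_f_set ?G B \<le> enat (card B) + enat t"
    unfolding th_f_set_def by (rule add_left_mono)
  also have "\<dots> \<le> enat (1 + \<alpha> * s + t)"
    using card by simp
  finally have "th_f_set ?G B \<le> enat (1 + \<alpha> * s + t)" .
  moreover have "th_f ?G \<le> th_f_set ?G B"
    unfolding th_f_def using \<open>B \<subseteq> pverts ?G\<close>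
    by (intro Min_le) (auto simp: balanced_spider_def finite_spider_verts)
  ultimately show ?thesis by simp
qed

section \<open>Arbitrary configurations\<close>

abbreviation leg_part :: "spider_vertex set \<Rightarrow> nat \<Rightarrow> nat set" where
  "leg_part B i \<equiv> {j. Leg i j \<in> B}"

lemma finite_leg_part:
  assumes "B \<subseteq> spider_verts \<alpha> \<beta>"
  shows "finite (leg_part B i)"
  by (rule finite_subset[of _ "{1..\<beta>}"]) (use assms in \<open>auto simp: spider_verts_def\<close>)

lemma card_by_legs:
  assumes "B \<subseteq> spider_verts \<alpha> \<beta>"
  shows "card B = (if Center \<in> B then 1 else 0) + (\<Sum>i\<in>{1..\<alpha>}. card (leg_part B i))"
proof -
  let ?P = "Sigma {1..\<alpha>} (leg_part B)"
  let ?L = "(\<lambda>(i, j). Leg i j) ` ?P"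
  have B: "B = (if Center \<in> B then {Center} else {}) \<union> ?L"
    using assms by (auto simp: spider_verts_def image_iff split: if_splits)
  have fin: "finite ?L"
    using finite_leg_part[OF assms] by auto
  have "card ?L = card ?P"
    by (rule card_image) (auto simp: inj_on_def)
  also have "\<dots> = (\<Sum>i\<in>{1..\<alpha>}. card (leg_part B i))"
    using finite_leg_part[OF assms] by (intro card_SigmaI) auto
  finally have card: "card ?L = (\<Sum>i\<in>{1..\<alpha>}. card (leg_part B i))" .
  have "card B = card ((if Center \<in> B then {Center} else {}) \<union> ?L)"
    using B by simp
  also have "\<dots> = (if Center \<in> B then 1 else 0) + card ?L"
    using fin by (subst card_Un_disjoint) auto
  finally show ?thesis unfolding card .
qed

lemma card_near_le:
  fixes J :: "nat set"
  assumes "finite J"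
  shows "finite (\<Union>j\<in>J. {j - k..j + k})" "card (\<Union>j\<in>J. {j - k..j + k}) \<le> card J * (2 * k + 1)"
proof -
  have "card (\<Union>j\<in>J. {j - k..j + k}) \<le> (\<Sum>j\<in>J. card {j - k..j + k})"
    using assms by (rule card_UN_le)
  also have "\<dots> \<le> (\<Sum>j\<in>J. 2 * k + 1)"
    by (rule sum_mono) auto
  finally show "card (\<Union>j\<in>J. {j - k..j + k}) \<le> card J * (2 * k + 1)" by simp
qed (use assms in auto)

text \<open>Whatever enters the leg from outside comes through the center and covers at most the
  first \<open>k\<close> positions.\<close>
lemma leg_length_le:
  assumes B: "B \<subseteq> spider_verts \<alpha> \<beta>"
    and full: "(full_forcing_step (balanced_spider \<alpha> \<beta>) ^^ k) B = spider_verts \<alpha> \<beta>"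
    and i: "i \<in> {1..\<alpha>}"
  shows "\<beta> \<le> k + card (leg_part B i) * (2 * k + 1)"
proof -
  let ?U = "\<Union>j\<in>leg_part B i. {j - k..j + k}"
  note U = card_near_le[OF finite_leg_part[OF B, of i], of k]
  have "{1..\<beta>} \<subseteq> {1..k} \<union> ?U"
  proof
    fix j assume j: "j \<in> {1..\<beta>}"
    then have "Leg i j \<in> spider_verts \<alpha> \<beta>" using i by (auto simp: spider_verts_def)
    then obtain u where u: "u \<in> B" "spider_dist u (Leg i j) \<le> k"
      using full_forcing_within_distance full by blast
    then show "j \<in> {1..k} \<union> ?U"
      using j by (cases u) (force split: if_splits)+
  qed
  then have "card {1..\<beta>} \<le> card ({1..k} \<union> ?U)"
    using U(1) by (intro card_mono) auto
  also have "\<dots> \<le> card {1..k} + card ?U"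
    by (rule card_Un_le)
  finally show ?thesis using U(2) by simp
qed

text \<open>The leg that contains a vertex of \<open>B\<close> nearest to the center gains nothing from the
  other legs: what they reach on it, this vertex also reaches.\<close>
lemma nearest_leg_length_less:
  assumes B: "B \<subseteq> spider_verts \<alpha> \<beta>"
    and full: "(full_forcing_step (balanced_spider \<alpha> \<beta>) ^^ k) B = spider_verts \<alpha> \<beta>"
    and "Center \<notin> B"
  obtains i where "i \<in> {1..\<alpha>}" "\<beta> + 1 \<le> card (leg_part B i) * (2 * k + 1)"
proof -
  have "Center \<in> spider_verts \<alpha> \<beta>" by (simp add: spider_verts_def)
  then obtain u where "u \<in> B"
    using full_forcing_within_distance full by blast
  then have "\<exists>d i. Leg i d \<in> B"
    using assms(3) by (cases u) auto
  define d where "d = (LEAST d. \<exists>i. Leg i d \<in> B)"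
  obtain i where i: "Leg i d \<in> B"
    using LeastI_ex[OF \<open>\<exists>d i. Leg i d \<in> B\<close>] unfolding d_def by blast
  have nearest: "d \<le> j'" if "Leg i' j' \<in> B" for i' j'
    unfolding d_def using that by (intro Least_le) blast
  have iA: "i \<in> {1..\<alpha>}" using i B by (auto simp: spider_verts_def)
  let ?U = "\<Union>j\<in>leg_part B i. {j - k..j + k}"
  note U = card_near_le[OF finite_leg_part[OF B, of i], of k]
  have "{0..\<beta>} \<subseteq> ?U"
  proof
    fix j assume j: "j \<in> {0..\<beta>}"
    then have "leg_pos i j \<in> spider_verts \<alpha> \<beta>"
      using leg_pos_in_verts[OF iA, of j \<beta>] by (simp add: balanced_spider_def)
    then obtain u where u: "u \<in> B" "spider_dist u (leg_pos i j) \<le> k"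
      using full_forcing_within_distance full by blast
    then obtain i' j' where u': "u = Leg i' j'"
      using assms(3) by (cases u) auto
    show "j \<in> ?U"
    proof (cases "i' = i")
      case True
      then have "j' \<in> leg_part B i" "j \<in> {j' - k..j' + k}"
        using u u' by (auto simp: leg_pos_def split: if_splits)
      then show ?thesis by blast
    next
      case False
      then have "j' + j \<le> k" using u u' by (auto simp: leg_pos_def split: if_splits)
      then have "j \<in> {d - k..d + k}" using nearest[of i' j'] u u' by auto
      then show ?thesis using i by blast
    qed
  qed
  then have "card {0..\<beta>} \<le> card ?U"
    using U(1) by (intro card_mono) auto
  then show thesis using that[OF iA] U(2) by simp
qed

text \<open>The exchange that pays for a missing center, in the case that every leg has as many
  vertices of \<open>B\<close> as the one covered from inside.\<close>
lemma center_exchange: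
  fixes \<alpha> \<beta> k m :: nat
  assumes "\<alpha> \<ge> 3" and cover: "\<beta> + 1 \<le> m * (2 * k + 1)"
  obtains n q where "2 * \<beta> + 1 \<le> (2 * n + 1) * (2 * q + 1)" "1 + \<alpha> * n + q \<le> \<alpha> * m + k"
proof -
  have "m \<ge> 1" using cover by (cases m) auto
  then obtain m' where m': "m = Suc m'" by (cases m) auto
  show thesis
  proof (cases "k \<ge> 2 * m")
    case True
    then obtain k' where k': "k = Suc k'" using \<open>m \<ge> 1\<close> by (cases k) auto
    have "2 * \<beta> + 1 \<le> (2 * m + 1) * (2 * k' + 1)"
      using cover True unfolding k' by (simp add: algebra_simps)
    then show thesis by (rule that) (simp add: k')
  next
    case False
    obtain a where a: "\<alpha> = a + 3" using assms(1) by (metis le_add_diff_inverse2)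
    \<comment> \<open>the two time steps gained when \<open>\<alpha> = 3\<close> already restore the covering condition\<close>
    have "2 * \<beta> + 1 \<le> (2 * m' + 1) * (2 * (k + 2) + 1)"
      using cover False unfolding m' by (simp add: algebra_simps)
    also have "\<dots> \<le> (2 * m' + 1) * (2 * (k + a + 2) + 1)"
      by (intro mult_left_mono) auto
    finally show thesis by (rule that) (simp add: m' a algebra_simps)
  qed
qed

lemma symmetric_configuration_dominates:
  assumes "\<alpha> \<ge> 3" and B: "B \<subseteq> spider_verts \<alpha> \<beta>"
    and full: "(full_forcing_step (balanced_spider \<alpha> \<beta>) ^^ k) B = spider_verts \<alpha> \<beta>"
  obtains n q where "2 * \<beta> + 1 \<le> (2 * n + 1) * (2 * q + 1)" "1 + \<alpha> * n + q \<le> card B + k"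
proof -
  let ?c = "\<lambda>i. card (leg_part B i)"
  define n where "n = Min (?c ` {1..\<alpha>})"
  have n_le: "n \<le> ?c i" if "i \<in> {1..\<alpha>}" for i
    unfolding n_def using that by (intro Min_le) auto
  have "n \<in> ?c ` {1..\<alpha>}"
    unfolding n_def using assms(1) by (intro Min_in) auto
  then obtain i0 where "i0 \<in> {1..\<alpha>}" "n = ?c i0" by auto
  then have "\<beta> \<le> k + n * (2 * k + 1)"
    using leg_length_le[OF B full] by simp
  then have cover: "2 * \<beta> + 1 \<le> (2 * n + 1) * (2 * k + 1)"
    by (simp add: algebra_simps)
  have sum_ge: "\<alpha> * n \<le> (\<Sum>i\<in>{1..\<alpha>}. ?c i)"
    using sum_mono[of "{1..\<alpha>}" "\<lambda>_. n" ?c] n_le by simp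
  show thesis
  proof (cases "Center \<in> B")
    case True
    then show thesis
      using that[OF cover] card_by_legs[OF B] sum_ge by simp
  next
    case False
    obtain i where i: "i \<in> {1..\<alpha>}" and inner: "\<beta> + 1 \<le> ?c i * (2 * k + 1)"
      by (rule nearest_leg_length_less[OF B full False])
    have cardB: "card B = (\<Sum>i\<in>{1..\<alpha>}. ?c i)"
      using card_by_legs[OF B] False by simp
    show thesis
    proof (cases "n < ?c i")
      case True
      have "(\<Sum>i\<in>{1..\<alpha>}. n) < (\<Sum>i\<in>{1..\<alpha>}. ?c i)"
        using n_le i True by (intro sum_strict_mono_ex1) auto
      then show thesis
        using that[OF cover] cardB by simp
    next
      case False
      then have "?c i = n" using n_le[OF i] by simp
      then have "\<beta> + 1 \<le> n * (2 * k + 1)" using inner by simp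
      then obtain n' q where cover': "2 * \<beta> + 1 \<le> (2 * n' + 1) * (2 * q + 1)"
        and cost: "1 + \<alpha> * n' + q \<le> \<alpha> * n + k"
        by (rule center_exchange[OF assms(1)])
      have "1 + \<alpha> * n' + q \<le> card B + k"
        using cost sum_ge cardB by linarith
      then show thesis by (rule that[OF cover'])
    qed
  qed
qed

lemma th_f_spider_ge:
  assumes "\<alpha> \<ge> 3"
    and minimal: "\<And>n q. 2 * \<beta> + 1 \<le> (2 * n + 1) * (2 * q + 1) \<Longrightarrow> N \<le> 1 + \<alpha> * n + q"
  shows "enat N \<le> th_f (balanced_spider \<alpha> \<beta>)"
proof -
  let ?G = "balanced_spider \<alpha> \<beta>"
  have V: "pverts ?G = spider_verts \<alpha> \<beta>" by (simp add: balanced_spider_def)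
  have "enat N \<le> th_f_set ?G B" if B: "B \<subseteq> spider_verts \<alpha> \<beta>" for B
  proof -
    have "enat (N - card B) \<le> pt_f ?G B"
      unfolding pt_f_def
    proof (rule Inf_greatest)
      fix x assume "x \<in> {enat k |k. (full_forcing_step ?G ^^ k) B = pverts ?G}"
      then obtain k where x: "x = enat k"
        and full: "(full_forcing_step ?G ^^ k) B = spider_verts \<alpha> \<beta>"
        using V by auto
      obtain n q where "2 * \<beta> + 1 \<le> (2 * n + 1) * (2 * q + 1)" "1 + \<alpha> * n + q \<le> card B + k"
        by (rule symmetric_configuration_dominates[OF assms(1) B full])
      then have "N \<le> card B + k" using minimal[of n q] by linarith
      then show "enat (N - card B) \<le> x" by (simp add: x)
    qed
    then have "enat (card B) + enat (N - card B) \<le> th_f_set ?G B"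
      unfolding th_f_set_def by (rule add_left_mono)
    moreover have "enat N \<le> enat (card B) + enat (N - card B)" by simp
    ultimately show ?thesis by (rule order.trans[rotated])
  qed
  then show ?thesis
    unfolding th_f_def V by (subst Min_ge_iff) (auto simp: finite_spider_verts)
qed

section \<open>The best evenly spaced configuration\<close>

text \<open>For real \<open>k\<close> the least cost with \<open>n\<close> vertices per leg is, up to a constant,
  \<open>h n = \<alpha> * n + (2 * \<beta> + 1) / (2 * (2 * n + 1))\<close>, and
  \<open>h n - h s = (n - s) * (\<alpha> - (2 * \<beta> + 1) / ((2 * n + 1) * (2 * s + 1)))\<close>. The choice of
  \<open>s\<close> makes the two factors agree in sign: it puts \<open>(2 * \<beta> + 1) / \<alpha>\<close> between
  \<open>4 * s\<^sup>2 - 1\<close> and \<open>4 * (s + 1)\<^sup>2 - 1\<close>, that is, between the products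
  \<open>(2 * s - 1) * (2 * s + 1)\<close> and \<open>(2 * s + 1) * (2 * s + 3)\<close>.\<close>
lemma symmetric_cost_minimum:
  fixes \<alpha> \<beta> n k :: nat and s t :: int
  assumes "\<alpha> \<ge> 1"
    and s: "s = \<lfloor>sqrt ((2 * real \<beta> + real \<alpha> + 1) / (4 * real \<alpha>))\<rfloor>"
    and t: "t = \<lceil>(real \<beta> - real_of_int s) / (2 * real_of_int s + 1)\<rceil>"
    and cover: "2 * \<beta> + 1 \<le> (2 * n + 1) * (2 * k + 1)"
  shows "int \<alpha> * s + t \<le> int \<alpha> * int n + int k"
proof -
  define S N b where "S = real_of_int s" and "N = real n" and "b = 2 * real \<beta> + 1"
  let ?a = "real \<alpha>"
  let ?R = "(2 * real \<beta> + ?a + 1) / (4 * ?a)"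
  have a: "?a > 0" using assms(1) by simp
  have "?R \<ge> 0" by simp
  have S0: "S \<ge> 0" unfolding S_def s by simp
  have "S \<le> sqrt ?R" "sqrt ?R < S + 1"
    unfolding S_def s by linarith+
  then have "S\<^sup>2 \<le> ?R" "?R < (S + 1)\<^sup>2"
    using S0 \<open>?R \<ge> 0\<close> power_mono[of S "sqrt ?R" 2] power_strict_mono[of "sqrt ?R" "S + 1" 2]
    by simp_all
  then have lo: "?a * ((2 * S - 1) * (2 * S + 1)) \<le> b"
    and hi: "b \<le> ?a * ((2 * S + 3) * (2 * S + 1))"
    using a by (auto simp: field_simps power2_eq_square b_def)
  have N0: "N \<ge> 0" by (simp add: N_def)
  have "0 \<le> (N - S) * (?a * ((2 * N + 1) * (2 * S + 1)) - b)"
  proof -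
    consider "n = nat s" | "int n \<le> s - 1" | "int n \<ge> s + 1" by linarith
    then show ?thesis
    proof cases
      case 1
      then show ?thesis using S0 by (simp add: N_def S_def)
    next
      case 2
      then have NS: "N \<le> S - 1" unfolding N_def S_def by linarith
      then have "?a * ((2 * N + 1) * (2 * S + 1)) \<le> ?a * ((2 * S - 1) * (2 * S + 1))"
        using a S0 by (intro mult_left_mono mult_right_mono) auto
      then show ?thesis using lo NS by (intro mult_nonpos_nonpos) auto
    next
      case 3
      then have NS: "N \<ge> S + 1" unfolding N_def S_def by linarith
      then have "?a * ((2 * S + 3) * (2 * S + 1)) \<le> ?a * ((2 * N + 1) * (2 * S + 1))"
        using a S0 by (intro mult_left_mono mult_right_mono) auto
      then show ?thesis using hi NS by (intro mult_nonneg_nonneg) auto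
    qed
  qed
  then have "0 \<le> (N - S) * (?a * ((2 * N + 1) * (2 * S + 1)) - b) / ((2 * N + 1) * (2 * S + 1))"
    using N0 S0 by simp
  also have "\<dots> = (?a * N + b / (2 * (2 * N + 1))) - (?a * S + b / (2 * (2 * S + 1)))"
  proof -
    have "2 * N + 1 \<noteq> 0" "2 * S + 1 \<noteq> 0" using N0 S0 by linarith+
    then show ?thesis by (simp add: divide_simps) (simp add: algebra_simps)
  qed
  finally have le: "?a * S + b / (2 * (2 * S + 1)) \<le> ?a * N + b / (2 * (2 * N + 1))" by simp
  have "b \<le> (2 * N + 1) * (2 * real k + 1)"
    unfolding b_def N_def using of_nat_mono[OF cover, where 'a = real] by (simp add: algebra_simps)
  then have "b / (2 * (2 * N + 1)) \<le> real k + 1 / 2"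
    using N0 by (simp add: field_simps)
  moreover have "(real \<beta> - S) / (2 * S + 1) = b / (2 * (2 * S + 1)) - 1 / 2"
    using S0 by (simp add: field_simps b_def)
  ultimately have "(real \<beta> - S) / (2 * S + 1) \<le> ?a * N + real k - ?a * S"
    using le by linarith
  also have "\<dots> = real_of_int (int \<alpha> * int n + int k - int \<alpha> * s)"
    by (simp add: N_def S_def)
  finally have "t \<le> int \<alpha> * int n + int k - int \<alpha> * s"
    unfolding t S_def by (simp only: ceiling_le_iff)
  then show ?thesis by simp
qed

theorem theorem3p3:
  fixes \<alpha> \<beta> :: nat and s t :: int
  assumes "\<alpha> \<ge> 3" and "\<beta> \<ge> 1"
    and "s = \<lfloor>sqrt ((2 * real \<beta> + real \<alpha> + 1) / (4 * real \<alpha>))\<rfloor>"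
    and "t = \<lceil>(real \<beta> - real_of_int s) / (2 * real_of_int s + 1)\<rceil>"
  shows "ereal_of_enat (th_f (balanced_spider \<alpha> \<beta>)) = ereal (real_of_int (1 + int \<alpha> * s + t)) \<and>
         t = \<lceil>(real \<beta> + 1 / 2) / (2 * real_of_int s + 1) - 1 / 2\<rceil>"
proof
  have s0: "s \<ge> 0" unfolding assms(3) by simp
  then have pos: "2 * real_of_int s + 1 > 0" by simp
  have shift: "(real \<beta> - real_of_int s) / (2 * real_of_int s + 1)
      = (real \<beta> + 1 / 2) / (2 * real_of_int s + 1) - 1 / 2"
    using pos by (simp add: field_simps)
  then show "t = \<lceil>(real \<beta> + 1 / 2) / (2 * real_of_int s + 1) - 1 / 2\<rceil>"
    using assms(4) by simp
  have "(real \<beta> + 1 / 2) / (2 * real_of_int s + 1) \<ge> 0"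
    using pos by simp
  then have t0: "t \<ge> 0"
    unfolding assms(4) shift by linarith
  obtain s' t' where nats: "s = int s'" "t = int t'"
    using s0 t0 nonneg_int_cases by metis
  have "(real \<beta> - real_of_int s) / (2 * real_of_int s + 1) \<le> real_of_int t"
    unfolding assms(4) by (rule le_of_int_ceiling)
  then have "real \<beta> - real_of_int s \<le> real_of_int t * (2 * real_of_int s + 1)"
    using pos by (simp add: pos_divide_le_eq)
  then have "real (2 * \<beta> + 1) \<le> real ((2 * s' + 1) * (2 * t' + 1))"
    by (simp add: nats algebra_simps)
  then have "2 * \<beta> + 1 \<le> (2 * s' + 1) * (2 * t' + 1)"
    by (simp only: of_nat_le_iff)
  then have "th_f (balanced_spider \<alpha> \<beta>) \<le> enat (1 + \<alpha> * s' + t')"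
    using assms(1) by (intro th_f_spider_le) auto
  moreover have "enat (1 + \<alpha> * s' + t') \<le> th_f (balanced_spider \<alpha> \<beta>)"
  proof (rule th_f_spider_ge[OF assms(1)])
    fix n q :: nat
    assume "2 * \<beta> + 1 \<le> (2 * n + 1) * (2 * q + 1)"
    then have "int \<alpha> * s + t \<le> int \<alpha> * int n + int q"
      using assms(1) by (intro symmetric_cost_minimum[OF _ assms(3,4)]) auto
    then have "int (\<alpha> * s' + t') \<le> int (\<alpha> * n + q)"
      by (simp add: nats)
    then have "\<alpha> * s' + t' \<le> \<alpha> * n + q"
      by (simp only: of_nat_le_iff)
    then show "1 + \<alpha> * s' + t' \<le> 1 + \<alpha> * n + q" by simp
  qed
  ultimately have "th_f (balanced_spider \<alpha> \<beta>) = enat (1 + \<alpha> * s' + t')"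
    by (rule antisym)
  then show "ereal_of_enat (th_f (balanced_spider \<alpha> \<beta>)) = ereal (real_of_int (1 + int \<alpha> * s + t))"
    by (simp add: nats)
qed

end
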